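(* Let $n$ be a positive integer and let $(\mathcal{A},\mathcal{B})$ be a $(2,n)$-bounded $1$-cross-intersecting set pair system. Then the number of non-isolated vertices (vertices lying in at least one edge of $\mathcal{A}$ or of $\mathcal{B}$) is at most \[ \frac{(n+3)^3}{27}+\frac{n+3}{3}, \] and this is the best possible.
   Context: A pair of edge-labelled hypergraphs $(\mathcal{A},\mathcal{B})$ is a set pair system (SPS) if $E(\mathcal{A})=\{e_1,\dots,e_m\}$ and $E(\mathcal{B})=\{f_1,\dots,f_m\}$ satisfy: $e_i\cap f_j\neq\varnothing$ if and only if $i\neq j$. It is $(a,b)$-bounded if every edge of $\mathcal{A}$ has size at most $a$ and every edge of $\mathcal{B}$ has size at most $b$. It is $1$-cross-intersecting if every pair $(e_i,f_j)$ with $e_i\cap f_j\neq\varnothing$ satisfies $|e_i\cap f_j|=1$.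
   Formalization: The bound is proved for n ≥ 2, since it fails for n = 1 (edges {0,1},{2,3} with partners {2},{0} give 4 > 100/27 vertices); "best possible" is stated as equality being attained for every n divisible by 3, the only n for which the bound is an integer. *)

theory Defs
  imports Complex_Main
begin

text \<open>
  A pair of edge-labelled hypergraphs with edges \<open>e\<^sub>1, \<dots>, e\<^sub>m\<close> and \<open>f\<^sub>1, \<dots>, f\<^sub>m\<close> is given by
  two families \<open>A, B :: nat \<Rightarrow> 'a set\<close>, of which only the values at labels in \<open>{1..m}\<close> matter.
\<close>

definition set_pair_system :: "nat \<Rightarrow> (nat \<Rightarrow> 'a set) \<Rightarrow> (nat \<Rightarrow> 'a set) \<Rightarrow> bool" where
  "set_pair_system m A B \<longleftrightarrow>
     (\<forall>i\<in>{1..m}. \<forall>j\<in>{1..m}. A i \<inter> B j \<noteq> {} \<longleftrightarrow> i \<noteq> j)"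

text \<open>Finiteness is required explicitly because \<open>card\<close> is \<open>0\<close> on infinite sets.\<close>

definition sps_bounded ::
    "nat \<Rightarrow> nat \<Rightarrow> nat \<Rightarrow> (nat \<Rightarrow> 'a set) \<Rightarrow> (nat \<Rightarrow> 'a set) \<Rightarrow> bool" where
  "sps_bounded a b m A B \<longleftrightarrow>
     (\<forall>i\<in>{1..m}. finite (A i) \<and> card (A i) \<le> a) \<and>
     (\<forall>i\<in>{1..m}. finite (B i) \<and> card (B i) \<le> b)"

definition one_cross_intersecting :: "nat \<Rightarrow> (nat \<Rightarrow> 'a set) \<Rightarrow> (nat \<Rightarrow> 'a set) \<Rightarrow> bool" where
  "one_cross_intersecting m A B \<longleftrightarrow>
     (\<forall>i\<in>{1..m}. \<forall>j\<in>{1..m}. A i \<inter> B j \<noteq> {} \<longrightarrow> card (A i \<inter> B j) = 1)"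

definition non_isolated :: "nat \<Rightarrow> (nat \<Rightarrow> 'a set) \<Rightarrow> (nat \<Rightarrow> 'a set) \<Rightarrow> 'a set" where
  "non_isolated m A B = {v. \<exists>i\<in>{1..m}. v \<in> A i \<or> v \<in> B i}"

text \<open>
  The upper bound \<open>(n + 3)\<^sup>3 / 27 + (n + 3) / 3\<close> on the number of non-isolated vertices of a
  \<open>(2,n)\<close>-bounded system fails for \<open>n = 1\<close>, where it equals \<open>100 / 27 < 4\<close>: take two disjoint
  edges \<open>{0,1}\<close> and \<open>{2,3}\<close>, with partners \<open>{2}\<close> and \<open>{0}\<close>.
\<close>

lemma vertex_bound_fails_for_1:
  "\<exists>m (A :: nat \<Rightarrow> nat set) B.
     set_pair_system m A B \<and> sps_bounded 2 1 m A B \<and> one_cross_intersecting m A B \<and>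
     real (card (non_isolated m A B)) > (real 1 + 3) ^ 3 / 27 + (real 1 + 3) / 3"
proof -
  define A :: "nat \<Rightarrow> nat set" where "A = (\<lambda>i. if i = 1 then {0,1} else {2,3})"
  define B :: "nat \<Rightarrow> nat set" where "B = (\<lambda>i. if i = 1 then {2} else {0})"
  have I: "{1..2} = {1, 2 :: nat}" by auto
  have "set_pair_system 2 A B" "sps_bounded 2 1 2 A B" "one_cross_intersecting 2 A B"
    unfolding set_pair_system_def sps_bounded_def one_cross_intersecting_def I
    by (simp_all add: A_def B_def)
  moreover have "non_isolated 2 A B = {0, 1, 2, 3}"
    unfolding non_isolated_def I by (auto simp: A_def B_def)
  then have "real (card (non_isolated 2 A B)) > (real 1 + 3) ^ 3 / 27 + (real 1 + 3) / 3"
    by simp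
  ultimately show ?thesis by blast
qed

end

theory Submission
  imports Defs "HOL-Library.Countable" "HOL-Library.Disjoint_Sets"
begin

text \<open>
  Since every \<open>f\<^sub>i\<close> meets each edge \<open>e\<^sub>j\<close> with \<open>j \<noteq> i\<close> in exactly one vertex and misses \<open>e\<^sub>i\<close>, the graph
  formed by the \<open>e\<^sub>i\<close> is a forest or a single odd cycle. In a tree with colour classes of sizes
  \<open>x \<le> y\<close>, each vertex of a class of size \<open>z\<close> lies in exactly \<open>z - 1\<close> of the sets \<open>f\<^sub>i\<close> belonging to
  edges of that tree, while every other \<open>f\<^sub>i\<close> contains exactly one of the two classes. This bounds
  the sum of the \<open>|f\<^sub>i \<inter> V|\<close> from below, hence the number of vertices outside \<open>V = \<Union> e\<^sub>i\<close> from above.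
  For the bound, such a tree is no better than \<open>x\<close> disjoint stars, and for \<open>c\<close> stars with \<open>d\<close> edges
  each the count is \<open>c d (n + 3 - c - d) + c\<close>. Equality holds for \<open>c = d = n / 3 + 1\<close>.
\<close>

section \<open>An integer cubic inequality\<close>

text \<open>With \<open>N = n + 3\<close>, this compares the count for \<open>c\<close> stars with
  \<open>d\<close> edges each to the target, both times 27; equality holds at
  \<open>c = d = N / 3\<close>. For \<open>N = 4\<close> it fails at \<open>c = 2\<close>,
  \<open>d = 1\<close>.\<close>

lemma cubic_bound:
  fixes N c d :: int
  assumes N: "N \<ge> 5" and c: "0 \<le> c" "c \<le> N"
  shows "27 * (c * (d * (N - c - d)) + c) \<le> N ^ 3 + 9 * N"
proof -
  \<comment> \<open>For integral \<open>d\<close> the product \<open>d (N - c - d)\<close> is largest at \<open>p\<close>; without integrality the bound fails.\<close>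
  define p where "p = (N - c) div 2"
  define q where "q = N - c - p"
  have pq: "q = p \<or> q = p + 1" and p0: "p \<ge> 0" using c unfolding p_def q_def by linarith+
  have S: "N - c = p + q" by (simp add: q_def)
  have "(d - p) * (d - q) \<ge> 0"
    using pq by (cases "d \<le> p") (auto simp: zero_le_mult_iff)
  then have "d * (N - c - d) \<le> p * q" unfolding S by (simp add: algebra_simps)
  then have "c * (d * (N - c - d)) \<le> c * (p * q)" using c by (intro mult_left_mono) auto
  moreover have "27 * (c * (p * q) + c) \<le> N ^ 3 + 9 * N"
  proof -
    \<comment> \<open>The deviation of \<open>c\<close> from the balanced choice. Once
      \<open>N\<close> and \<open>c\<close> are written through \<open>p\<close> and
      \<open>e\<close>, the terms in \<open>p ^ 3\<close> and \<open>p ^ 2\<close> cancel and the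
      difference of the two sides is linear in \<open>p\<close>.\<close>
    define e where "e = c - p"
    have ce: "c = p + e" by (simp add: e_def)
    show ?thesis
    proof (cases "q = p")
      case True
      then have Ne: "N = 3 * p + e" using S ce by simp
      have "0 \<le> e * (e * (9 * p + e) - 18)"
      proof (cases "e \<le> 0")
        case True
        have "9 * p + e \<ge> 0" using c p0 ce by linarith
        then have "e * (9 * p + e) \<le> 0" using True by (simp add: mult_nonpos_nonneg)
        then show ?thesis using True by (intro mult_nonpos_nonpos) auto
      next
        case False
        have "e * (9 * p + e) \<ge> 18"
        \<comment> \<open>The tight cases are \<open>e = 1\<close> and \<open>p = 0\<close>. Both
          rely on \<open>N \<ge> 5\<close>, which forces \<open>p \<ge> 2\<close> in the first and
          \<open>e \<ge> 5\<close> in the second.\<close>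
        proof (cases "e = 1")
          case True
          then have "p \<ge> 2" using Ne N by linarith
          then show ?thesis using True by simp
        next
          case e1: False
          show ?thesis
          proof (cases "p = 0")
            case True
            then have "e \<ge> 5" using Ne N by simp
            then show ?thesis using True mult_mono[of 5 e 5 e] by simp
          next
            case p1: False
            then show ?thesis using False e1 p0 mult_mono[of 2 e 9 "9 * p + e"] by simp
          qed
        qed
        then show ?thesis using False by simp
      qed
      also have "\<dots> = N ^ 3 + 9 * N - 27 * (c * (p * q) + c)"
        unfolding True Ne ce by (simp add: algebra_simps power3_eq_cube)
      finally show ?thesis by simp
    next
      case False
      then have qp: "q = p + 1" using pq by simp
      then have Ne: "N = 3 * p + e + 1" using S ce by simp
      have "0 \<le> 9 * (p * (e * e - e + 1)) + (e + 1) ^ 3 + 9 - 18 * e"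
      proof (cases "e \<le> 0")
        case True
        \<comment> \<open>Since \<open>c = p + e\<close> is nonnegative, \<open>p\<close> is at
          least \<open>- e\<close>. Putting \<open>- e\<close> for \<open>p\<close> leaves a
          polynomial in \<open>- e\<close> with nonnegative coefficients.\<close>
        have "(- e) * (e * e - e + 1) \<le> p * (e * e - e + 1)"
        proof (rule mult_right_mono)
          show "0 \<le> e * e - e + 1" using True zero_le_square[of e] by linarith
        qed (use c ce in linarith)
        then have "9 * ((- e) * (e * e - e + 1)) \<le> 9 * (p * (e * e - e + 1))" by simp
        moreover have "9 * ((- e) * (e * e - e + 1)) + (e + 1) ^ 3 + 9 - 18 * e
            = 8 * ((- e) * (e * e)) + 12 * (e * e) + 24 * (- e) + 10"
          by (simp add: algebra_simps power3_eq_cube)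
        moreover have "(- e) * (e * e) \<ge> 0" "e * e \<ge> 0" using True by (auto simp: mult_nonpos_nonneg)
        ultimately show ?thesis using True by linarith
      next
        case False
        have ee: "e * e - e + 1 \<ge> 1" using False mult_right_mono[of 1 e e] by simp
        have pe: "p * (e * e - e + 1) \<ge> p" using mult_left_mono[OF ee p0] by simp
        show ?thesis
        proof (cases "e = 1")
          case True
          then show ?thesis using Ne N by simp
        next
          case e1: False
          \<comment> \<open>Among positive \<open>e\<close> this product is negative only at
            \<open>e = 1\<close>, where the term in \<open>p\<close> has to make up for it.\<close>
          then have "(e - 2) * (e * e + 5 * e - 5) \<ge> 0"
            using False zero_le_square[of e] by (intro mult_nonneg_nonneg) linarith+
          also have "\<dots> = (e + 1) ^ 3 + 9 - 18 * e" by (simp add: algebra_simps power3_eq_cube)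
          finally show ?thesis using pe p0 by linarith
        qed
      qed
      also have "\<dots> = N ^ 3 + 9 * N - 27 * (c * (p * q) + c)"
        unfolding qp Ne ce by (simp add: algebra_simps power3_eq_cube)
      finally show ?thesis by simp
    qed
  qed
  ultimately show ?thesis using mult_left_mono[of _ _ "27 :: int"] add_right_mono
    by (smt (verit, best))
qed

section \<open>Graphs with partner sets, and their tree components\<close>

locale uniform_cross_pair =
  fixes I :: "'i set" and E F :: "'i \<Rightarrow> 'a set"
  assumes finite_I: "finite I"
    and card_E: "i \<in> I \<Longrightarrow> card (E i) = 2"
    and E_F_disjoint: "i \<in> I \<Longrightarrow> E i \<inter> F i = {}"
    and card_E_F: "i \<in> I \<Longrightarrow> j \<in> I \<Longrightarrow> i \<noteq> j \<Longrightarrow> card (E i \<inter> F j) = 1"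
begin

text \<open>This makes each \<open>F j\<close> a proper 2-colouring of the graph with the edge
  \<open>E j\<close> deleted, so that on a connected part it is determined by a single
  vertex.\<close>

lemma mem_F_iff_not_mem_F:
  assumes "i \<in> I" "j \<in> I" "i \<noteq> j" "E i = {u, v}" "u \<noteq> v"
  shows "u \<in> F j \<longleftrightarrow> v \<notin> F j"
  using card_E_F[OF assms(1-3)] assms(4,5)
  by (cases "u \<in> F j"; cases "v \<in> F j") (auto simp: Int_insert_left)

text \<open>
  \<open>X\<close> and \<open>Y\<close> are the colour classes and \<open>T\<close> the edge labels of a component. Acyclicity and
  connectedness enter only through the edge count and the last three conditions, which are exactly
  what survives joining two components by an edge. A class may be empty: an isolated vertex is
  a tree.
\<close>

definition tree :: "'a set \<Rightarrow> 'a set \<Rightarrow> 'i set \<Rightarrow> bool" where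
  "tree X Y T \<longleftrightarrow> finite X \<and> finite Y \<and> X \<inter> Y = {} \<and> T \<subseteq> I \<and> card T + 1 = card X + card Y \<and>
     (\<forall>i\<in>T. E i \<subseteq> X \<union> Y \<and> E i \<inter> X \<noteq> {} \<and> E i \<inter> Y \<noteq> {}) \<and>
     (\<forall>w\<in>X. card {i \<in> T. w \<in> F i} + 1 = card X) \<and>
     (\<forall>w\<in>Y. card {i \<in> T. w \<in> F i} + 1 = card Y) \<and>
     (\<forall>j\<in>I - T. F j \<inter> (X \<union> Y) = X \<or> F j \<inter> (X \<union> Y) = Y)"

lemma tree_sym: "tree X Y T \<Longrightarrow> tree Y X T"
  unfolding tree_def by (auto simp: Un_commute)

lemma tree_singleton: "tree {v} {} {}"
  unfolding tree_def by auto

text \<open>For \<open>w\<close> in \<open>X1\<close>, the labels in \<open>T1\<close> contribute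
  \<open>card X1 - 1\<close>. For \<open>i\<close> in \<open>T2\<close>, alternation along
  \<open>E j\<close> puts \<open>w\<close> into \<open>F i\<close> iff \<open>v\<close> is outside
  \<open>F i\<close>, which happens for \<open>card T2 - (card Y2 - 1) = card X2\<close> labels. For
  \<open>w\<close> in \<open>Y1\<close> the condition on \<open>v\<close> is reversed and
  \<open>j\<close> adds one. Vertices of the second tree are covered by exchanging the
  trees.\<close>

lemma tree_merge_count:
  assumes t1: "tree X1 Y1 T1" and t2: "tree X2 Y2 T2"
    and dV: "(X1 \<union> Y1) \<inter> (X2 \<union> Y2) = {}" and dT: "T1 \<inter> T2 = {}"
    and j: "j \<in> I" "j \<notin> T1" "j \<notin> T2" and Ej: "E j = {u, v}" "u \<in> X1" "v \<in> Y2"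
  shows "w \<in> X1 \<Longrightarrow> card {i \<in> insert j (T1 \<union> T2). w \<in> F i} + 1 = card X1 + card X2"
    and "w \<in> Y1 \<Longrightarrow> card {i \<in> insert j (T1 \<union> T2). w \<in> F i} + 1 = card Y1 + card Y2"
    and "i \<in> I \<Longrightarrow> i \<notin> insert j (T1 \<union> T2) \<Longrightarrow>
           F i \<inter> (X1 \<union> X2 \<union> (Y1 \<union> Y2)) = X1 \<union> X2 \<or> F i \<inter> (X1 \<union> X2 \<union> (Y1 \<union> Y2)) = Y1 \<union> Y2"
proof -
  have T: "T1 \<subseteq> I" "T2 \<subseteq> I" using t1 t2 by (auto simp: tree_def)
  then have fin: "finite T1" "finite T2" using finite_I finite_subset by auto
  have uv: "u \<noteq> v" using Ej dV by auto
  have one: "u \<in> F i \<longleftrightarrow> v \<notin> F i" if "i \<in> I" "i \<noteq> j" for i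
    using mem_F_iff_not_mem_F[of j i u v] that j Ej uv by auto
  have side1: "F i \<inter> (X1 \<union> Y1) = (if u \<in> F i then X1 else Y1)" if "i \<in> I" "i \<notin> T1" for i
  proof -
    have "F i \<inter> (X1 \<union> Y1) = X1 \<or> F i \<inter> (X1 \<union> Y1) = Y1" "X1 \<inter> Y1 = {}"
      using t1 that unfolding tree_def by blast+
    then show ?thesis using Ej(2) by auto
  qed
  have side2: "F i \<inter> (X2 \<union> Y2) = (if v \<in> F i then Y2 else X2)" if "i \<in> I" "i \<notin> T2" for i
  proof -
    have "F i \<inter> (X2 \<union> Y2) = X2 \<or> F i \<inter> (X2 \<union> Y2) = Y2" "X2 \<inter> Y2 = {}"
      using t2 that unfolding tree_def by blast+
    then show ?thesis using Ej(3) by auto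
  qed
  have notj: "u \<notin> F j" "v \<notin> F j" using E_F_disjoint[OF j(1)] Ej by auto
  have X1Y1: "X1 \<inter> Y1 = {}" using t1 by (auto simp: tree_def)
  have split: "{i \<in> T2. v \<in> F i} \<union> {i \<in> T2. v \<notin> F i} = T2" by auto
  have "card {i \<in> T2. v \<in> F i} + card {i \<in> T2. v \<notin> F i} = card T2"
    using fin by (subst card_Un_disjoint[symmetric]) (auto simp: split)
  moreover have cv: "card {i \<in> T2. v \<in> F i} + 1 = card Y2" "card T2 + 1 = card X2 + card Y2"
    using t2 Ej by (auto simp: tree_def)
  ultimately have nv: "card {i \<in> T2. v \<notin> F i} = card X2" by simp
  show "card {i \<in> insert j (T1 \<union> T2). w \<in> F i} + 1 = card X1 + card X2" if w: "w \<in> X1"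
  proof -
    have "w \<in> F i \<longleftrightarrow> v \<notin> F i" if "i \<in> T2" for i
    proof -
      have i: "i \<in> I" "i \<notin> T1" "i \<noteq> j" using that T dT j by auto
      have "w \<in> F i \<longleftrightarrow> w \<in> F i \<inter> (X1 \<union> Y1)" using w by auto
      then show ?thesis using side1[OF i(1,2)] one[OF i(1,3)] w X1Y1 by auto
    qed
    moreover have "w \<notin> F j" using side1[of j] notj j w X1Y1 by auto
    ultimately have "{i \<in> insert j (T1 \<union> T2). w \<in> F i} = {i \<in> T1. w \<in> F i} \<union> {i \<in> T2. v \<notin> F i}"
      by auto
    moreover have "card ({i \<in> T1. w \<in> F i} \<union> {i \<in> T2. v \<notin> F i})
        = card {i \<in> T1. w \<in> F i} + card {i \<in> T2. v \<notin> F i}"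
      using fin dT by (intro card_Un_disjoint) auto
    moreover have "card {i \<in> T1. w \<in> F i} + 1 = card X1" using t1 w by (auto simp: tree_def)
    ultimately show ?thesis using nv by simp
  qed
  show "card {i \<in> insert j (T1 \<union> T2). w \<in> F i} + 1 = card Y1 + card Y2" if w: "w \<in> Y1"
  proof -
    have "w \<in> F i \<longleftrightarrow> v \<in> F i" if "i \<in> T2" for i
    proof -
      have i: "i \<in> I" "i \<notin> T1" "i \<noteq> j" using that T dT j by auto
      have "w \<in> F i \<longleftrightarrow> w \<in> F i \<inter> (X1 \<union> Y1)" using w by auto
      then show ?thesis using side1[OF i(1,2)] one[OF i(1,3)] w X1Y1 by auto
    qed
    \<comment> \<open>\<open>F j\<close> misses \<open>u\<close>, so on the first tree it is the
      class \<open>Y1\<close>.\<close>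
    moreover have "w \<in> F j" using side1[of j] notj j w X1Y1 by auto
    ultimately have "{i \<in> insert j (T1 \<union> T2). w \<in> F i}
        = insert j ({i \<in> T1. w \<in> F i} \<union> {i \<in> T2. v \<in> F i})"
      by auto
    moreover have "card ({i \<in> T1. w \<in> F i} \<union> {i \<in> T2. v \<in> F i})
        = card {i \<in> T1. w \<in> F i} + card {i \<in> T2. v \<in> F i}"
      using fin dT by (intro card_Un_disjoint) auto
    moreover have "card {i \<in> T1. w \<in> F i} + 1 = card Y1" using t1 w by (auto simp: tree_def)
    ultimately show ?thesis using cv fin j by simp
  qed
  show "F i \<inter> (X1 \<union> X2 \<union> (Y1 \<union> Y2)) = X1 \<union> X2 \<or> F i \<inter> (X1 \<union> X2 \<union> (Y1 \<union> Y2)) = Y1 \<union> Y2"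
    if i: "i \<in> I" "i \<notin> insert j (T1 \<union> T2)"
  proof -
    have "F i \<inter> (X1 \<union> X2 \<union> (Y1 \<union> Y2)) = F i \<inter> (X1 \<union> Y1) \<union> F i \<inter> (X2 \<union> Y2)" by auto
    then show ?thesis using side1[of i] side2[of i] one[of i] i by (auto split: if_splits)
  qed
qed

lemma tree_merge:
  assumes t1: "tree X1 Y1 T1" and t2: "tree X2 Y2 T2"
    and dV: "(X1 \<union> Y1) \<inter> (X2 \<union> Y2) = {}" and dT: "T1 \<inter> T2 = {}"
    and j: "j \<in> I" "j \<notin> T1" "j \<notin> T2" and Ej: "E j = {u, v}" "u \<in> X1" "v \<in> Y2"
  shows "tree (X1 \<union> X2) (Y1 \<union> Y2) (insert j (T1 \<union> T2))"
proof -
  note c1 = tree_merge_count[OF assms]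
  have dV': "(Y2 \<union> X2) \<inter> (Y1 \<union> X1) = {}" and dT': "T2 \<inter> T1 = {}" and Ej': "E j = {v, u}"
    using dV dT Ej by auto
  \<comment> \<open>Exchanging the trees and both colour orders puts \<open>v\<close> into a first
    class and \<open>u\<close> into a second one, as the count requires.\<close>
  note c2 = tree_merge_count(1,2)[OF tree_sym[OF t2] tree_sym[OF t1] dV' dT' j(1,3,2) Ej'(1) Ej(3,2)]
  have [simp]: "insert j (T2 \<union> T1) = insert j (T1 \<union> T2)" by auto
  have fin: "finite X1" "finite X2" "finite Y1" "finite Y2" using t1 t2 by (auto simp: tree_def)
  have T: "T1 \<subseteq> I" "T2 \<subseteq> I" using t1 t2 by (auto simp: tree_def)
  then have finT: "finite T1" "finite T2" using finite_I finite_subset by auto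
  have cX: "card (X1 \<union> X2) = card X1 + card X2" and cY: "card (Y1 \<union> Y2) = card Y1 + card Y2"
    using fin dV by (auto intro!: card_Un_disjoint)
  have cT: "card (insert j (T1 \<union> T2)) = card T1 + card T2 + 1"
    using finT dT j by (simp add: card_Un_disjoint)
  have e: "card T1 + 1 = card X1 + card Y1" "card T2 + 1 = card X2 + card Y2"
    using t1 t2 by (auto simp: tree_def)
  have dXY: "(X1 \<union> X2) \<inter> (Y1 \<union> Y2) = {}" using t1 t2 dV by (auto simp: tree_def)
  have inc: "E i \<subseteq> (X1 \<union> X2) \<union> (Y1 \<union> Y2) \<and> E i \<inter> (X1 \<union> X2) \<noteq> {} \<and> E i \<inter> (Y1 \<union> Y2) \<noteq> {}"
    if i: "i \<in> insert j (T1 \<union> T2)" for i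
  proof -
    consider "i = j" | "i \<in> T1" | "i \<in> T2" using i by auto
    then show ?thesis
    proof cases
      case 2
      then have "E i \<subseteq> X1 \<union> Y1 \<and> E i \<inter> X1 \<noteq> {} \<and> E i \<inter> Y1 \<noteq> {}" using t1 unfolding tree_def by blast
      then show ?thesis by blast
    next
      case 3
      then have "E i \<subseteq> X2 \<union> Y2 \<and> E i \<inter> X2 \<noteq> {} \<and> E i \<inter> Y2 \<noteq> {}" using t2 unfolding tree_def by blast
      then show ?thesis by blast
    qed (use Ej in auto)
  qed
  have "\<forall>w\<in>X1 \<union> X2. card {i \<in> insert j (T1 \<union> T2). w \<in> F i} + 1 = card (X1 \<union> X2)"
    using c1(1) c2(2) unfolding cX by auto
  moreover have "\<forall>w\<in>Y1 \<union> Y2. card {i \<in> insert j (T1 \<union> T2). w \<in> F i} + 1 = card (Y1 \<union> Y2)"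
    using c1(2) c2(1) unfolding cY by auto
  moreover have "\<forall>i\<in>I - insert j (T1 \<union> T2).
      F i \<inter> (X1 \<union> X2 \<union> (Y1 \<union> Y2)) = X1 \<union> X2 \<or> F i \<inter> (X1 \<union> X2 \<union> (Y1 \<union> Y2)) = Y1 \<union> Y2"
    using c1(3) by blast
  moreover have "card (insert j (T1 \<union> T2)) + 1 = card (X1 \<union> X2) + card (Y1 \<union> Y2)"
    using cX cY cT e by simp
  ultimately show ?thesis using dXY inc fin T j(1) unfolding tree_def by blast
qed

section \<open>Decomposition into a forest or an odd cycle\<close>

text \<open>The components cover all vertices of the graph whichever labels \<open>J\<close> have
  been inserted; vertices not yet reached are singleton trees.\<close>

definition forest :: "('a set \<times> 'a set \<times> 'i set) set \<Rightarrow> 'i set \<Rightarrow> bool" where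
  "forest K J \<longleftrightarrow> finite K \<and> (\<forall>(X, Y, T)\<in>K. tree X Y T) \<and>
     disjoint_family_on (\<lambda>(X, Y, T). X \<union> Y) K \<and> disjoint_family_on (\<lambda>(X, Y, T). T) K \<and>
     (\<Union>(X, Y, T)\<in>K. X \<union> Y) = \<Union> (E ` I) \<and> (\<Union>(X, Y, T)\<in>K. T) = J"

text \<open>
  The colouring condition on the remaining sets \<open>F i\<close> forces an edge inside a component to close an
  odd cycle, and then to be the only edge missing from that component.
\<close>

definition odd_cycle :: bool where
  "odd_cycle \<longleftrightarrow> (\<exists>X Y j u v. tree X Y (I - {j}) \<and> X \<union> Y \<subseteq> \<Union> (E ` I) \<and> j \<in> I \<and>
      E j = {u, v} \<and> u \<noteq> v \<and> u \<in> X \<and> v \<in> X)"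

lemma finite_E: "i \<in> I \<Longrightarrow> finite (E i)"
  using card_E[of i] card.infinite by fastforce

lemma forest_empty: "\<exists>K. forest K {}"
proof
  have "finite (\<Union> (E ` I))" using finite_I finite_E by auto
  then show "forest ((\<lambda>v. ({v}, {}, {})) ` \<Union> (E ` I)) {}"
    unfolding forest_def using tree_singleton by (auto simp: disjoint_family_on_def)
qed

text \<open>\<open>F j\<close> contains one whole colour class and misses \<open>u\<close> and
  \<open>v\<close>, so both lie in the other class. The set of any further label outside
  \<open>T\<close> would contain both or neither of them, against alternation along
  \<open>E j\<close>.\<close>

lemma odd_cycle_of_edge_in_tree:
  assumes t: "tree X Y T" and V: "X \<union> Y \<subseteq> \<Union> (E ` I)" and j: "j \<in> I" "j \<notin> T"
    and Ej: "E j = {u, v}" "u \<noteq> v" "u \<in> X" "v \<in> X \<union> Y"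
  shows odd_cycle
proof -
  have disj: "X \<inter> Y = {}" using t by (auto simp: tree_def)
  have side: "F i \<inter> (X \<union> Y) = X \<or> F i \<inter> (X \<union> Y) = Y" if "i \<in> I" "i \<notin> T" for i
    using t that by (auto simp: tree_def)
  have "u \<notin> F j" "v \<notin> F j" using E_F_disjoint[OF j(1)] Ej by auto
  then have v: "v \<in> X" using side[OF j] Ej disj by auto
  have "i \<in> T" if i: "i \<in> I" "i \<noteq> j" for i
  proof (rule ccontr)
    assume "i \<notin> T"
    then show False
      using side[OF i(1)] mem_F_iff_not_mem_F[OF j(1) i(1) _ Ej(1,2)] i(2) v Ej(3) disj by auto
  qed
  moreover have "T \<subseteq> I" using t by (auto simp: tree_def)
  ultimately have "T = I - {j}" using j by auto
  then show ?thesis unfolding odd_cycle_def using t V j Ej v by blast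
qed

text \<open>The endpoints of \<open>E j\<close> lie either in one component, where the edge closes
  an odd cycle, or in two, which it joins into one tree.\<close>

lemma forest_insert:
  assumes f: "forest K J" and j: "j \<in> I" "j \<notin> J"
  shows "odd_cycle \<or> (\<exists>K'. forest K' (insert j J))"
proof -
  obtain u v where Ej: "E j = {u, v}" "u \<noteq> v" using card_E[OF j(1)] by (meson card_2_iff)
  have V: "(\<Union>(X, Y, T)\<in>K. X \<union> Y) = \<Union> (E ` I)" and Js: "(\<Union>(X, Y, T)\<in>K. T) = J"
    using f by (auto simp: forest_def)
  have tr: "tree X Y T" if "(X, Y, T) \<in> K" for X Y T using f that by (auto simp: forest_def)
  have dV: "(X \<union> Y) \<inter> (X' \<union> Y') = {}" and dT: "T \<inter> T' = {}"
    if "(X, Y, T) \<in> K" "(X', Y', T') \<in> K" "(X, Y, T) \<noteq> (X', Y', T')" for X Y T X' Y' T'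
  proof -
    have "disjoint_family_on (\<lambda>(X, Y, T). X \<union> Y) K" "disjoint_family_on (\<lambda>(X, Y, T). T) K"
      using f unfolding forest_def by simp_all
    from this[THEN disjoint_family_onD, OF that]
    show "(X \<union> Y) \<inter> (X' \<union> Y') = {}" "T \<inter> T' = {}" by simp_all
  qed
  have uv: "u \<in> (\<Union>(X, Y, T)\<in>K. X \<union> Y)" "v \<in> (\<Union>(X, Y, T)\<in>K. X \<union> Y)"
    unfolding V using Ej j by auto
  obtain X1 Y1 T1 where k1: "(X1, Y1, T1) \<in> K" "u \<in> X1 \<union> Y1" using uv(1) by auto
  obtain X2 Y2 T2 where k2: "(X2, Y2, T2) \<in> K" "v \<in> X2 \<union> Y2" using uv(2) by auto
  have jT: "j \<notin> T1" "j \<notin> T2" using j Js k1 k2 by auto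
  show ?thesis
  proof (cases "(X1, Y1, T1) = (X2, Y2, T2)")
    case True
    then have "v \<in> X1 \<union> Y1" "v \<in> Y1 \<union> X1" using k2 by auto
    moreover have "X1 \<union> Y1 \<subseteq> \<Union> (E ` I)" "Y1 \<union> X1 \<subseteq> \<Union> (E ` I)"
      unfolding V[symmetric] using UN_upper[OF k1(1), of "\<lambda>(X, Y, T). X \<union> Y"] by (simp_all add: Un_commute)
    ultimately show ?thesis
      using odd_cycle_of_edge_in_tree[OF tr[OF k1(1)] _ j(1) jT(1) Ej]
        odd_cycle_of_edge_in_tree[OF tree_sym[OF tr[OF k1(1)]] _ j(1) jT(1) Ej] k1(2) by (metis UnE)
  next
    case False
    \<comment> \<open>Merging needs \<open>u\<close> in a first class and \<open>v\<close> in a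
      second one; the classes of either tree may be swapped for this.\<close>
    obtain X1' Y1' where t1: "tree X1' Y1' T1" "u \<in> X1'" "X1' \<union> Y1' = X1 \<union> Y1"
      using k1(2) tr[OF k1(1)] tree_sym[OF tr[OF k1(1)]] by (metis Un_commute Un_iff)
    obtain X2' Y2' where t2: "tree X2' Y2' T2" "v \<in> Y2'" "X2' \<union> Y2' = X2 \<union> Y2"
      using k2(2) tr[OF k2(1)] tree_sym[OF tr[OF k2(1)]] by (metis Un_commute Un_iff)
    define k where "k = (X1' \<union> X2', Y1' \<union> Y2', insert j (T1 \<union> T2))"
    define K0 where "K0 = K - {(X1, Y1, T1), (X2, Y2, T2)}"
    have t: "tree (X1' \<union> X2') (Y1' \<union> Y2') (insert j (T1 \<union> T2))"
      using tree_merge[OF t1(1) t2(1) _ _ j(1) jT Ej(1) t1(2) t2(2)]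
        dV[OF k1(1) k2(1) False] dT[OF k1(1) k2(1) False] t1(3) t2(3) by simp
    have kV: "X1' \<union> X2' \<union> (Y1' \<union> Y2') = (X1 \<union> Y1) \<union> (X2 \<union> Y2)" using t1(3) t2(3) by blast
    have K: "K = insert (X1, Y1, T1) (insert (X2, Y2, T2) K0)" using k1 k2 by (auto simp: K0_def)
    have sep: "(X1' \<union> X2' \<union> (Y1' \<union> Y2')) \<inter> (X \<union> Y) = {}" "insert j (T1 \<union> T2) \<inter> T = {}"
      if "(X, Y, T) \<in> K0" for X Y T
    proof -
      have XYT: "(X, Y, T) \<in> K" "(X1, Y1, T1) \<noteq> (X, Y, T)" "(X2, Y2, T2) \<noteq> (X, Y, T)"
        using that by (auto simp: K0_def)
      show "(X1' \<union> X2' \<union> (Y1' \<union> Y2')) \<inter> (X \<union> Y) = {}"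
        using dV[OF k1(1) XYT(1,2)] dV[OF k2(1) XYT(1,3)] unfolding kV by blast
      have "j \<notin> T" using XYT(1) Js j by auto
      then show "insert j (T1 \<union> T2) \<inter> T = {}"
        using dT[OF k1(1) XYT(1,2)] dT[OF k2(1) XYT(1,3)] by blast
    qed
    have "forest (insert k K0) (insert j J)"
      unfolding forest_def
    proof (intro conjI)
      show "finite (insert k K0)" using f by (simp add: forest_def K0_def)
      show "\<forall>(X, Y, T)\<in>insert k K0. tree X Y T" using t tr by (auto simp: k_def K0_def)
      have "k \<notin> K0" using sep(2) by (auto simp: k_def)
      moreover have "disjoint_family_on (\<lambda>(X, Y, T). X \<union> Y) K0" "disjoint_family_on (\<lambda>(X, Y, T). T) K0"
        using f disjoint_family_on_mono[of K0 K] by (auto simp: forest_def K0_def)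
      moreover have "(case k of (X, Y, T) \<Rightarrow> X \<union> Y) \<inter> (\<Union>(X, Y, T)\<in>K0. X \<union> Y) = {}"
        using sep(1) unfolding k_def by (simp add: disjoint_iff) blast
      moreover have "(case k of (X, Y, T) \<Rightarrow> T) \<inter> (\<Union>(X, Y, T)\<in>K0. T) = {}"
        using sep(2) unfolding k_def by (simp add: disjoint_iff) blast
      ultimately show "disjoint_family_on (\<lambda>(X, Y, T). X \<union> Y) (insert k K0)"
        and "disjoint_family_on (\<lambda>(X, Y, T). T) (insert k K0)"
        by (simp_all add: disjoint_family_on_insert)
      show "(\<Union>(X, Y, T)\<in>insert k K0. X \<union> Y) = \<Union> (E ` I)"
        unfolding V[symmetric] K k_def using kV by (simp add: Un_assoc)
      show "(\<Union>(X, Y, T)\<in>insert k K0. T) = insert j J"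
        unfolding Js[symmetric] K k_def by (simp add: Un_assoc)
    qed
    then show ?thesis by blast
  qed
qed

text \<open>Edges are inserted one at a time. \<open>odd_cycle\<close> speaks of all of
  \<open>I\<close>, so meeting it at any stage settles the claim.\<close>

lemma odd_cycle_or_forest: "odd_cycle \<or> (\<exists>K. forest K I)"
proof -
  have "odd_cycle \<or> (\<exists>K. forest K J)" if "J \<subseteq> I" for J
    using finite_subset[OF that finite_I] that
  proof (induction J rule: finite_induct)
    case empty
    show ?case using forest_empty by simp
  next
    case (insert j J)
    then show ?case using forest_insert[of _ J j] by blast
  qed
  then show ?thesis by blast
qed

section \<open>Double counting of incidences with the sets \<open>F i\<close>\<close>

lemma sum_card_F_Int:
  assumes "finite W" "finite T"
  shows "(\<Sum>i\<in>T. card (F i \<inter> W)) = (\<Sum>w\<in>W. card {i \<in> T. w \<in> F i})"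
proof -
  have "(\<Sum>i\<in>T. card (F i \<inter> W)) = (\<Sum>i\<in>T. \<Sum>w\<in>W. if w \<in> F i then 1 else 0)"
    using assms by (intro sum.cong) (auto simp: sum.If_cases Int_commute Collect_conj_eq)
  also have "\<dots> = (\<Sum>w\<in>W. \<Sum>i\<in>T. if w \<in> F i then 1 else 0)" by (rule sum.swap)
  also have "\<dots> = (\<Sum>w\<in>W. card {i \<in> T. w \<in> F i})"
    using assms by (intro sum.cong) (auto simp: sum.If_cases Collect_conj_eq)
  finally show ?thesis .
qed

lemma tree_sum_card:
  assumes t: "tree X Y T"
  shows "int (\<Sum>i\<in>T. card (F i \<inter> (X \<union> Y)))
    = int (card X) * (int (card X) - 1) + int (card Y) * (int (card Y) - 1)"
proof -
  have fin: "finite X" "finite Y" "X \<inter> Y = {}" "finite T"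
    using t finite_I finite_subset by (auto simp: tree_def)
  have cX: "int (card {i \<in> T. w \<in> F i}) = int (card X) - 1" if "w \<in> X" for w
    using t that unfolding tree_def by force
  have cY: "int (card {i \<in> T. w \<in> F i}) = int (card Y) - 1" if "w \<in> Y" for w
    using t that unfolding tree_def by force
  have "int (\<Sum>i\<in>T. card (F i \<inter> (X \<union> Y))) = (\<Sum>w\<in>X \<union> Y. int (card {i \<in> T. w \<in> F i}))"
    using fin by (subst sum_card_F_Int) auto
  also have "\<dots> = (\<Sum>w\<in>X. int (card {i \<in> T. w \<in> F i})) + (\<Sum>w\<in>Y. int (card {i \<in> T. w \<in> F i}))"
    using fin by (intro sum.union_disjoint) auto
  finally show ?thesis using cX cY by simp
qed

text \<open>Each \<open>F i\<close> has at most \<open>n\<close> minus its incidences with the graph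
  left for vertices outside it. The incidences stand on the left to avoid subtraction on
  \<open>nat\<close>.\<close>

lemma card_vertices_le:
  assumes F: "\<And>i. i \<in> I \<Longrightarrow> finite (F i) \<and> card (F i) \<le> n"
  shows "card (\<Union> (E ` I) \<union> \<Union> (F ` I)) + (\<Sum>i\<in>I. card (F i \<inter> \<Union> (E ` I)))
    \<le> card (\<Union> (E ` I)) + card I * n"
proof -
  let ?V = "\<Union> (E ` I)"
  have "?V \<union> \<Union> (F ` I) = ?V \<union> (\<Union>i\<in>I. F i - ?V)" by auto
  then have "card (?V \<union> \<Union> (F ` I)) \<le> card ?V + card (\<Union>i\<in>I. F i - ?V)"
    using card_Un_le[of ?V "\<Union>i\<in>I. F i - ?V"] by simp
  also have "card (\<Union>i\<in>I. F i - ?V) \<le> (\<Sum>i\<in>I. card (F i - ?V))"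
    by (rule card_UN_le[OF finite_I])
  finally have "card (?V \<union> \<Union> (F ` I)) + (\<Sum>i\<in>I. card (F i \<inter> ?V))
      \<le> card ?V + (\<Sum>i\<in>I. card (F i - ?V) + card (F i \<inter> ?V))"
    by (simp add: sum.distrib)
  also have "(\<Sum>i\<in>I. card (F i - ?V) + card (F i \<inter> ?V)) \<le> (\<Sum>i\<in>I. n)"
  proof (rule sum_mono)
    fix i assume i: "i \<in> I"
    have "card (F i) = card (F i - ?V) + card (F i \<inter> ?V)"
      using F[OF i] by (subst card_Un_disjoint[symmetric]) (auto intro: arg_cong[where f = card])
    then show "card (F i - ?V) + card (F i \<inter> ?V) \<le> n" using F[OF i] by simp
  qed
  finally show ?thesis by simp
qed

section \<open>The vertex bound for an odd cycle\<close>

text \<open>With \<open>x = card X\<close> the graph has \<open>2 * x - 1\<close> vertices and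
  equally many edges, and the total count is at most \<open>(2 * x - 1) * (N - 1 - x)\<close>. This
  is no more than the count for \<open>x\<close> or for \<open>x - 1\<close> stars with two edges
  each, so \<open>cubic_bound\<close> applies with \<open>d = 2\<close>.\<close>

lemma odd_cycle_bound:
  assumes odd: odd_cycle and n: "n \<ge> 2"
    and F: "\<And>i. i \<in> I \<Longrightarrow> finite (F i) \<and> card (F i) \<le> n"
  shows "27 * int (card (\<Union> (E ` I) \<union> \<Union> (F ` I))) \<le> (int n + 3) ^ 3 + 9 * (int n + 3)"
proof -
  obtain X Y j u v where t: "tree X Y (I - {j})" and sub: "X \<union> Y \<subseteq> \<Union> (E ` I)" and j: "j \<in> I"
    and Ej: "E j = {u, v}" "u \<noteq> v" "u \<in> X" "v \<in> X"
    using odd unfolding odd_cycle_def by blast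
  let ?V = "\<Union> (E ` I)" let ?T = "I - {j}"
  define x y where "x = int (card X)" and "y = int (card Y)"
  have XY: "finite X" "finite Y" "X \<inter> Y = {}" using t by (auto simp: tree_def)
  have V: "?V \<subseteq> X \<union> Y"
  proof
    fix w assume "w \<in> ?V"
    then obtain i where i: "i \<in> I" "w \<in> E i" by auto
    show "w \<in> X \<union> Y"
    proof (cases "i = j")
      case False
      then have "E i \<subseteq> X \<union> Y" using t i unfolding tree_def by blast
      then show ?thesis using i by auto
    qed (use i Ej in auto)
  qed
  have cT: "int (card ?T) + 1 = x + y" using t by (simp add: tree_def x_def y_def)
  have cI: "int (card I) = x + y"
    using cT card_Suc_Diff1[OF finite_I j] by linarith
  have FjV: "F j \<inter> (X \<union> Y) = Y"
  proof -
    have "F j \<inter> (X \<union> Y) = X \<or> F j \<inter> (X \<union> Y) = Y" using t j unfolding tree_def by blast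
    moreover have "u \<notin> F j" using E_F_disjoint[OF j] Ej by auto
    ultimately show ?thesis using Ej by blast
  qed
  \<comment> \<open>Both \<open>u\<close> and \<open>v\<close> lie in \<open>X\<close>, and each
    label of the tree selects exactly one of them. So the tree has \<open>2 * (x - 1)\<close> edges,
    which determines \<open>y\<close>.\<close>
  have "int (card {i \<in> ?T. u \<in> F i}) = x - 1" "int (card {i \<in> ?T. v \<in> F i}) = x - 1"
    using t Ej unfolding tree_def x_def by force+
  moreover have "card {i \<in> ?T. u \<in> F i} + card {i \<in> ?T. v \<in> F i} = card ?T"
  proof -
    have "u \<in> F i \<longleftrightarrow> v \<notin> F i" if "i \<in> ?T" for i
      using mem_F_iff_not_mem_F[of j i u v] that j Ej by auto
    then have "{i \<in> ?T. u \<in> F i} \<inter> {i \<in> ?T. v \<in> F i} = {}"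
      "{i \<in> ?T. u \<in> F i} \<union> {i \<in> ?T. v \<in> F i} = ?T" by blast+
    then show ?thesis using finite_I by (subst card_Un_disjoint[symmetric]) auto
  qed
  ultimately have y: "y = x - 1" using cT by linarith
  have "{u, v} \<subseteq> X" using Ej by auto
  then have x2: "x \<ge> 2" using card_mono[OF XY(1), of "{u, v}"] Ej(2) by (simp add: x_def)
  have VXY: "?V = X \<union> Y" using V sub by blast
  have cV: "int (card ?V) = 2 * x - 1"
    unfolding VXY using XY y by (simp add: card_Un_disjoint x_def y_def)
  have "int (\<Sum>i\<in>I. card (F i \<inter> ?V)) = int (\<Sum>i\<in>?T. card (F i \<inter> (X \<union> Y))) + y"
    using FjV by (simp add: VXY sum.remove[OF finite_I j] y_def)
  also have "\<dots> = (2 * x - 1) * (x - 1)"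
    unfolding tree_sum_card[OF t] x_def[symmetric] y_def[symmetric] y by (simp add: algebra_simps)
  finally have sum: "int (\<Sum>i\<in>I. card (F i \<inter> ?V)) = (2 * x - 1) * (x - 1)" .
  have cI': "int (card I) = 2 * x - 1" using cI y by simp
  \<comment> \<open>The incidences cannot exceed the total size of the \<open>F i\<close>; this
    keeps \<open>x\<close> in the range of \<open>cubic_bound\<close>.\<close>
  have "(\<Sum>i\<in>I. card (F i \<inter> ?V)) \<le> (\<Sum>i\<in>I. n)"
    using F by (intro sum_mono) (meson card_mono inf_le1 order_trans)
  then have "int (\<Sum>i\<in>I. card (F i \<inter> ?V)) \<le> int (card I) * int n"
    by (simp del: of_nat_sum flip: of_nat_mult)
  then have "(2 * x - 1) * (x - 1) \<le> (2 * x - 1) * int n" unfolding sum cI' .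
  then have xn: "x - 1 \<le> int n" using x2 by simp
  define N where "N = int n + 3"
  have N5: "N \<ge> 5" using n by (simp add: N_def)
  let ?U = "int (card (?V \<union> \<Union> (F ` I)))"
  have "?U + int (\<Sum>i\<in>I. card (F i \<inter> ?V)) \<le> int (card ?V) + int (card I) * int n"
    using card_vertices_le[OF F] by (simp del: of_nat_sum flip: of_nat_add of_nat_mult)
  then have U: "?U \<le> (2 * x - 1) * (N - 1 - x)"
    unfolding sum cV cI' N_def by (simp add: algebra_simps)
  show ?thesis
  \<comment> \<open>The product falls short of the count for \<open>x\<close> stars by
    \<open>N - 1 - 2 * x\<close> and of that for \<open>x - 1\<close> stars by
    \<open>2 * x - N\<close>; one of the two is nonnegative.\<close>
  proof (cases "2 * x \<le> N - 1")
    case True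
    have "(2 * x - 1) * (N - 1 - x) = x * (2 * (N - x - 2)) + x - (N - 1 - 2 * x)"
      by (simp add: algebra_simps)
    then have "?U \<le> x * (2 * (N - x - 2)) + x" using U True by linarith
    then have "27 * ?U \<le> 27 * (x * (2 * (N - x - 2)) + x)" by simp
    also have "\<dots> \<le> N ^ 3 + 9 * N" by (rule cubic_bound) (use N5 x2 xn in \<open>auto simp: N_def\<close>)
    finally show ?thesis by (simp add: N_def)
  next
    case False
    have "(2 * x - 1) * (N - 1 - x) = (x - 1) * (2 * (N - (x - 1) - 2)) + (x - 1) - (2 * x - N)"
      by (simp add: algebra_simps)
    then have "?U \<le> (x - 1) * (2 * (N - (x - 1) - 2)) + (x - 1)" using U False by linarith
    then have "27 * ?U \<le> 27 * ((x - 1) * (2 * (N - (x - 1) - 2)) + (x - 1))" by simp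
    also have "\<dots> \<le> N ^ 3 + 9 * N" by (rule cubic_bound) (use N5 x2 xn in \<open>auto simp: N_def\<close>)
    finally show ?thesis by (simp add: N_def)
  qed
qed

section \<open>The vertex bound for a forest\<close>

text \<open>Labels of the tree are counted exactly, and any other \<open>F i\<close> contains a
  whole colour class, hence at least \<open>x\<close> vertices. By \<open>cover\<close>, an edge at
  any vertex of the tree belongs to the tree, so neither class is empty.\<close>

lemma tree_sum_card_ge:
  assumes t: "tree X Y T" and V: "X \<union> Y \<subseteq> \<Union> (E ` I)"
    and cover: "\<And>i. i \<in> I \<Longrightarrow> i \<notin> T \<Longrightarrow> E i \<inter> (X \<union> Y) = {}"
    and x: "x = int (min (card X) (card Y))" and y: "y = int (max (card X) (card Y))"
  shows "1 \<le> x" "x \<le> y" "int (card T) = x + y - 1" "int (card (X \<union> Y)) = x + y"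
    "(int (card I) - int (card T)) * x + x * (x - 1) + y * (y - 1)
       \<le> int (\<Sum>i\<in>I. card (F i \<inter> (X \<union> Y)))"
proof -
  have fin: "finite X" "finite Y" "X \<inter> Y = {}" "T \<subseteq> I"
    and c: "card T + 1 = card X + card Y" using t by (auto simp: tree_def)
  have finT: "finite T" using fin finite_I finite_subset by auto
  have "X \<union> Y \<noteq> {}" using c by auto
  then obtain w where w: "w \<in> X \<union> Y" by blast
  then obtain i where i: "i \<in> I" "w \<in> E i" using V by blast
  then have "i \<in> T" using cover w by blast
  then have "X \<noteq> {}" "Y \<noteq> {}" using t unfolding tree_def by blast+
  then show "1 \<le> x" using fin unfolding x by (simp add: Suc_le_eq card_gt_0_iff)
  show "x \<le> y" unfolding x y by simp
  have xy: "x + y = int (card X) + int (card Y)" unfolding x y by (simp add: min_def max_def)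
  then show "int (card T) = x + y - 1" using c by linarith
  show "int (card (X \<union> Y)) = x + y" using xy fin by (simp add: card_Un_disjoint)
  have "int (\<Sum>i\<in>T. card (F i \<inter> (X \<union> Y))) = x * (x - 1) + y * (y - 1)"
    unfolding tree_sum_card[OF t] x y by (simp add: min_def max_def)
  moreover have "(int (card I) - int (card T)) * x \<le> int (\<Sum>i\<in>I - T. card (F i \<inter> (X \<union> Y)))"
  proof -
    have "(\<Sum>i\<in>I - T. min (card X) (card Y)) \<le> (\<Sum>i\<in>I - T. card (F i \<inter> (X \<union> Y)))"
    proof (rule sum_mono)
      fix i assume "i \<in> I - T"
      then have "F i \<inter> (X \<union> Y) = X \<or> F i \<inter> (X \<union> Y) = Y" using t unfolding tree_def by blast
      then show "min (card X) (card Y) \<le> card (F i \<inter> (X \<union> Y))" by auto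
    qed
    moreover have "int (card I) - int (card T) = int (card (I - T))"
      using fin finite_I finT by (simp add: card_Diff_subset card_mono of_nat_diff)
    ultimately show ?thesis unfolding x by (simp del: of_nat_sum flip: of_nat_mult)
  qed
  moreover have "(\<Sum>i\<in>I. card (F i \<inter> (X \<union> Y)))
      = (\<Sum>i\<in>I - T. card (F i \<inter> (X \<union> Y))) + (\<Sum>i\<in>T. card (F i \<inter> (X \<union> Y)))"
    by (rule sum.subset_diff[OF fin(4) finite_I])
  ultimately show "(int (card I) - int (card T)) * x + x * (x - 1) + y * (y - 1)
       \<le> int (\<Sum>i\<in>I. card (F i \<inter> (X \<union> Y)))" by linarith
qed

text \<open>The bound arises by averaging. After each tree is replaced by stars, \<open>C\<close>
  stars remain and one with \<open>d\<close> edges contributes \<open>d * (S - d) + 1\<close>.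
  Multiplied by \<open>C\<close>, this is the count for \<open>C\<close> equal stars, which
  \<open>cubic_bound\<close> estimates.\<close>

lemma forest_bound:
  assumes f: "forest K I" and I: "I \<noteq> {}" and n: "n \<ge> 2"
    and F: "\<And>i. i \<in> I \<Longrightarrow> finite (F i) \<and> card (F i) \<le> n"
  shows "27 * int (card (\<Union> (E ` I) \<union> \<Union> (F ` I))) \<le> (int n + 3) ^ 3 + 9 * (int n + 3)"
proof -
  let ?V = "\<Union> (E ` I)" and ?vs = "\<lambda>(X, Y, T). X \<union> Y" and ?ix = "\<lambda>(X, Y, T). T"
  define M where "M = int (card I)"
  define x y t s :: "'a set \<times> 'a set \<times> 'i set \<Rightarrow> int"
    where "x = (\<lambda>(X, Y, T). int (min (card X) (card Y)))"
    and "y = (\<lambda>(X, Y, T). int (max (card X) (card Y)))"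
    and "t = (\<lambda>k. int (card (?ix k)))"
    and "s = (\<lambda>k. int (\<Sum>i\<in>I. card (F i \<inter> ?vs k)))"
  have finK: "finite K" and tr: "\<And>X Y T. (X, Y, T) \<in> K \<Longrightarrow> tree X Y T"
    and dV: "disjoint_family_on ?vs K" and dT: "disjoint_family_on ?ix K"
    and V: "(\<Union>k\<in>K. ?vs k) = ?V" and IT: "(\<Union>k\<in>K. ?ix k) = I"
    using f by (auto simp: forest_def)
  have fin: "finite (?vs k)" "finite (?ix k)" if "k \<in> K" for k
    using that tr finite_subset[OF _ finite_I] by (auto simp: tree_def split: prod.splits)
  have k: "1 \<le> x k" "x k \<le> y k" "t k = x k + y k - 1" "int (card (?vs k)) = x k + y k"
    "(M - t k) * x k + x k * (x k - 1) + y k * (y k - 1) \<le> s k" if kK: "k \<in> K" for k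
  proof -
    obtain X Y T where XYT: "k = (X, Y, T)" by (cases k)
    have T: "tree X Y T" using kK tr XYT by simp
    have sub: "X \<union> Y \<subseteq> ?V" using UN_upper[OF kK, of ?vs] unfolding V XYT by simp
    have cov: "E i \<inter> (X \<union> Y) = {}" if i: "i \<in> I" "i \<notin> T" for i
    proof -
      obtain k' where k': "k' \<in> K" "i \<in> ?ix k'" using i(1) unfolding IT[symmetric] by blast
      obtain X' Y' T' where XYT': "k' = (X', Y', T')" by (cases k')
      have "E i \<subseteq> X' \<union> Y'" using tr[of X' Y' T'] k' unfolding XYT' tree_def by auto
      moreover have "k \<noteq> k'" using i(2) k' unfolding XYT XYT' by auto
      then have "(X \<union> Y) \<inter> (X' \<union> Y') = {}"
        using disjoint_family_onD[OF dV kK k'(1)] unfolding XYT XYT' by simp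
      ultimately show ?thesis by blast
    qed
    have xk: "x k = int (min (card X) (card Y))" and yk: "y k = int (max (card X) (card Y))"
      by (simp_all add: x_def y_def XYT)
    note g = tree_sum_card_ge[OF T sub cov xk yk]
    show "1 \<le> x k" "x k \<le> y k" using g(1,2) by simp_all
    show "t k = x k + y k - 1" "int (card (?vs k)) = x k + y k"
      using g(3,4) by (simp_all add: t_def XYT)
    show "(M - t k) * x k + x k * (x k - 1) + y k * (y k - 1) \<le> s k"
      using g(5) by (simp add: t_def s_def M_def XYT)
  qed
  have cV: "int (card ?V) = (\<Sum>k\<in>K. x k + y k)"
  proof -
    have "card ?V = (\<Sum>k\<in>K. card (?vs k))"
      unfolding V[symmetric]
    proof (intro card_UN_disjoint ballI impI)
      show "?vs k \<inter> ?vs k' = {}" if "k \<in> K" "k' \<in> K" "k \<noteq> k'" for k k'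
        by (rule disjoint_family_onD[OF dV that])
    qed (fact finK fin)+
    then show ?thesis using k(4) by simp
  qed
  have cI: "M = (\<Sum>k\<in>K. t k)"
  proof -
    have "card I = (\<Sum>k\<in>K. card (?ix k))"
      unfolding IT[symmetric]
    proof (intro card_UN_disjoint ballI impI)
      show "?ix k \<inter> ?ix k' = {}" if "k \<in> K" "k' \<in> K" "k \<noteq> k'" for k k'
        by (rule disjoint_family_onD[OF dT that])
    qed (fact finK fin)+
    then show ?thesis by (simp add: M_def t_def)
  qed
  have cS: "int (\<Sum>i\<in>I. card (F i \<inter> ?V)) = (\<Sum>k\<in>K. s k)"
  proof -
    have "card (F i \<inter> ?V) = (\<Sum>k\<in>K. card (F i \<inter> ?vs k))" for i
    proof -
      have "F i \<inter> ?V = (\<Union>k\<in>K. F i \<inter> ?vs k)" unfolding V[symmetric] by blast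
      moreover have "card (\<Union>k\<in>K. F i \<inter> ?vs k) = (\<Sum>k\<in>K. card (F i \<inter> ?vs k))"
      proof (intro card_UN_disjoint ballI impI)
        show "(F i \<inter> ?vs k) \<inter> (F i \<inter> ?vs k') = {}" if "k \<in> K" "k' \<in> K" "k \<noteq> k'" for k k'
          using disjoint_family_onD[OF dV that] by blast
      qed (fact finK, simp add: fin del: split_paired_All)
      ultimately show ?thesis by simp
    qed
    then have "(\<Sum>i\<in>I. card (F i \<inter> ?V)) = (\<Sum>k\<in>K. \<Sum>i\<in>I. card (F i \<inter> ?vs k))"
      by (simp add: sum.swap[of _ K I])
    then show ?thesis by (simp add: s_def)
  qed
  \<comment> \<open>The smaller class sizes add up to the total number of stars.\<close>
  define C where "C = (\<Sum>k\<in>K. x k)"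
  define N where "N = int n + 3"
  define S where "S = N - C"
  have N5: "N \<ge> 5" using n by (simp add: N_def)
  have M0: "M > 0" using I finite_I by (simp add: M_def card_gt_0_iff)
  have "K \<noteq> {}" using M0 cI by auto
  have "(\<Sum>k\<in>K. 1) \<le> C" unfolding C_def using k(1) by (intro sum_mono) auto
  moreover have "card K > 0" using \<open>K \<noteq> {}\<close> finK by (simp add: card_gt_0_iff)
  ultimately have C0: "C > 0" by simp
  \<comment> \<open>Comparing the incidences with the available \<open>M * n\<close> gives
    \<open>C \<le> n + 1\<close>, within the range of \<open>cubic_bound\<close>.\<close>
  have "M * C - M \<le> (\<Sum>k\<in>K. s k)"
  proof -
    have "M * C - M = (\<Sum>k\<in>K. M * x k - t k)"
      unfolding C_def by (subst (2) cI) (simp add: sum_subtractf sum_distrib_left)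
    also have "\<dots> \<le> (\<Sum>k\<in>K. s k)"
    proof (rule sum_mono)
      fix k assume kK: "k \<in> K"
      \<comment> \<open>For \<open>x k = y k\<close> the first product is \<open>- y k\<close>, and
        the second summand makes up for it.\<close>
      have "y k * (y k - x k - 1) + (x k + y k - 1) \<ge> 0"
      proof (cases "x k = y k")
        case True
        then show ?thesis using k(1)[OF kK] by simp
      next
        case False
        then have "y k * (y k - x k - 1) \<ge> 0" using k(1,2)[OF kK] by (intro mult_nonneg_nonneg) auto
        then show ?thesis using k(1,2)[OF kK] by linarith
      qed
      moreover have "(M - t k) * x k + x k * (x k - 1) + y k * (y k - 1) - (M * x k - t k)
          = y k * (y k - x k - 1) + (x k + y k - 1)"
        unfolding k(3)[OF kK] by (simp add: algebra_simps)
      ultimately show "M * x k - t k \<le> s k" using k(5)[OF kK] by linarith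
    qed
    finally show ?thesis .
  qed
  also have "(\<Sum>k\<in>K. s k) \<le> M * int n"
  proof -
    have "(\<Sum>i\<in>I. card (F i \<inter> ?V)) \<le> (\<Sum>i\<in>I. n)"
      using F by (intro sum_mono) (meson card_mono inf_le1 order_trans)
    then show ?thesis unfolding cS[symmetric] M_def by (simp del: of_nat_sum flip: of_nat_mult)
  qed
  finally have "M * (C - 1) \<le> M * int n" by (simp add: algebra_simps)
  then have CN: "C \<le> N" using M0 by (simp add: N_def)
  note cubic = cubic_bound[OF N5 less_imp_le[OF C0] CN, folded S_def]
  let ?U = "int (card (?V \<union> \<Union> (F ` I)))"
  have "?U + int (\<Sum>i\<in>I. card (F i \<inter> ?V)) \<le> int (card ?V) + M * int n"
    using card_vertices_le[OF F] by (simp add: M_def del: of_nat_sum flip: of_nat_add of_nat_mult)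
  then have "?U \<le> (\<Sum>k\<in>K. x k + y k) + M * int n - (\<Sum>k\<in>K. s k)" unfolding cS cV by simp
  also have "\<dots> = (\<Sum>k\<in>K. x k + y k + t k * int n - s k)"
    by (subst cI) (simp add: sum_subtractf sum.distrib sum_distrib_right)
  \<comment> \<open>Replace a tree by \<open>x\<close> stars: \<open>x - 1\<close> of them with two edges, one with \<open>y - x + 1\<close> edges.\<close>
  also have "\<dots> \<le> (\<Sum>k\<in>K. x k + t k * N - M * x k - (y k - x k + 1) ^ 2 - 4 * (x k - 1))"
  proof (rule sum_mono)
    fix k assume kK: "k \<in> K"
    \<comment> \<open>This product is what the replacement by stars gains; it vanishes when the tree
      is a star.\<close>
    have "(y k - x k) * (x k - 1) \<ge> 0" using k(1,2)[OF kK] by (intro mult_nonneg_nonneg) auto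
    moreover have "x k + t k * N - M * x k - (y k - x k + 1) ^ 2 - 4 * (x k - 1)
        = x k + y k + t k * int n - ((M - t k) * x k + x k * (x k - 1) + y k * (y k - 1))
          + (y k - x k) * (x k - 1)"
      unfolding k(3)[OF kK] N_def by (simp add: algebra_simps power2_eq_square)
    ultimately show "x k + y k + t k * int n - s k
        \<le> x k + t k * N - M * x k - (y k - x k + 1) ^ 2 - 4 * (x k - 1)"
      using k(5)[OF kK] by linarith
  qed
  also have "\<dots> = (\<Sum>k\<in>K. x k + t k * N - (y k - x k + 1) ^ 2 - 4 * (x k - 1)) - M * C"
    unfolding C_def by (simp add: sum_subtractf sum.distrib sum_distrib_left)
  \<comment> \<open>Since the \<open>t k\<close> add up to \<open>M\<close>, the term
    \<open>M * C\<close> can be distributed over the trees by edges, turning \<open>N\<close> into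
    \<open>S\<close>.\<close>
  also have "\<dots> = (\<Sum>k\<in>K. x k + t k * S - (y k - x k + 1) ^ 2 - 4 * (x k - 1))"
    unfolding S_def cI by (simp add: sum_subtractf sum.distrib sum_distrib_left algebra_simps)
  \<comment> \<open>The factor \<open>C\<close> lets every single star be compared with
    \<open>C\<close> equal copies of itself.\<close>
  finally have "(27 * C) * ?U
      \<le> (27 * C) * (\<Sum>k\<in>K. x k + t k * S - (y k - x k + 1) ^ 2 - 4 * (x k - 1))"
    using C0 by (intro mult_left_mono) auto
  also have "\<dots> = (\<Sum>k\<in>K. (27 * C) * (x k + t k * S - (y k - x k + 1) ^ 2 - 4 * (x k - 1)))"
    by (rule sum_distrib_left)
  also have "\<dots> \<le> (\<Sum>k\<in>K. x k * (N ^ 3 + 9 * N))"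
  proof (rule sum_mono)
    fix k assume kK: "k \<in> K"
    define d where "d = y k - x k + 1"
    have tk: "t k = 2 * (x k - 1) + d" using k(3)[OF kK] by (simp add: d_def)
    have "(27 * C) * (x k + t k * S - d ^ 2 - 4 * (x k - 1))
        = (x k - 1) * (27 * (C * (2 * (S - 2)) + C)) + 27 * (C * (d * (S - d)) + C)"
      unfolding tk by (simp add: algebra_simps power2_eq_square)
    also have "\<dots> \<le> (x k - 1) * (N ^ 3 + 9 * N) + (N ^ 3 + 9 * N)"
      using k(1)[OF kK] by (intro add_mono mult_left_mono cubic) simp
    finally show "(27 * C) * (x k + t k * S - (y k - x k + 1) ^ 2 - 4 * (x k - 1))
        \<le> x k * (N ^ 3 + 9 * N)"
      by (simp add: d_def algebra_simps)
  qed
  also have "\<dots> = C * (N ^ 3 + 9 * N)" by (simp add: C_def sum_distrib_right)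
  finally have "C * (27 * ?U) \<le> C * (N ^ 3 + 9 * N)" by (simp add: algebra_simps)
  then show ?thesis using C0 by (simp add: N_def)
qed

lemma card_vertices_bound:
  assumes n: "n \<ge> 2" and F: "\<And>i. i \<in> I \<Longrightarrow> finite (F i) \<and> card (F i) \<le> n"
  shows "27 * int (card (\<Union> (E ` I) \<union> \<Union> (F ` I))) \<le> (int n + 3) ^ 3 + 9 * (int n + 3)"
proof (cases "I = {}")
  case False
  then show ?thesis
    using odd_cycle_or_forest odd_cycle_bound[OF _ assms] forest_bound[OF _ False assms] by blast
qed simp

end

section \<open>From set pair systems to graphs\<close>

lemma set_pair_system_bound:
  fixes A B :: "nat \<Rightarrow> 'a set"
  assumes n: "n \<ge> 2" and sps: "set_pair_system m A B" and bd: "sps_bounded 2 n m A B"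
    and one: "one_cross_intersecting m A B"
  shows "real (card (non_isolated m A B)) \<le> (real n + 3) ^ 3 / 27 + (real n + 3) / 3"
proof -
  \<comment> \<open>Edges with fewer than two vertices are padded by fresh private vertices.\<close>
  define E :: "nat \<Rightarrow> ('a + nat \<times> nat) set"
    where "E i = Inl ` A i \<union> Inr ` ({i} \<times> {..<2 - card (A i)})" for i
  define F :: "nat \<Rightarrow> ('a + nat \<times> nat) set" where "F i = Inl ` B i" for i
  have EF: "E i \<inter> F j = Inl ` (A i \<inter> B j)" for i j by (auto simp: E_def F_def)
  have bA: "finite (A i)" "card (A i) \<le> 2" and bB: "finite (B i)" "card (B i) \<le> n"
    if "i \<in> {1..m}" for i using bd that by (auto simp: sps_bounded_def)
  interpret uniform_cross_pair "{1..m}" E F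
  proof
    fix i assume i: "i \<in> {1..m}"
    have "card (E i) = card (Inl ` A i :: ('a + nat \<times> nat) set)
        + card (Inr ` ({i} \<times> {..<2 - card (A i)}) :: ('a + nat \<times> nat) set)"
      unfolding E_def using bA[OF i] by (intro card_Un_disjoint) auto
    then show "card (E i) = 2" using bA[OF i] by (simp add: card_image)
    show "E i \<inter> F i = {}" using sps i by (simp add: EF set_pair_system_def)
    fix j assume "j \<in> {1..m}" "i \<noteq> j"
    then show "card (E i \<inter> F j) = 1"
      using sps one i by (simp add: EF set_pair_system_def one_cross_intersecting_def card_image)
  qed simp
  have F: "finite (F i) \<and> card (F i) \<le> n" if "i \<in> {1..m}" for i
    using bB[OF that] by (simp add: F_def card_image)
  have "finite (\<Union> (E ` {1..m}) \<union> \<Union> (F ` {1..m}))" using finite_E F by auto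
  \<comment> \<open>Padding only adds vertices and leaves the sizes of the partner sets unchanged,
    so the bound for the padded system suffices.\<close>
  moreover have "Inl ` non_isolated m A B \<subseteq> \<Union> (E ` {1..m}) \<union> \<Union> (F ` {1..m})"
    by (auto simp: non_isolated_def E_def F_def)
  ultimately have "card (Inl ` non_isolated m A B :: ('a + nat \<times> nat) set)
      \<le> card (\<Union> (E ` {1..m}) \<union> \<Union> (F ` {1..m}))"
    by (rule card_mono)
  then have "27 * int (card (non_isolated m A B)) \<le> (int n + 3) ^ 3 + 9 * (int n + 3)"
    using card_vertices_bound[OF n F] by (simp add: card_image)
  then have "real_of_int (27 * int (card (non_isolated m A B)))
      \<le> real_of_int ((int n + 3) ^ 3 + 9 * (int n + 3))"
    by (simp only: of_int_le_iff)
  then show ?thesis by (simp add: field_simps)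
qed

section \<open>The extremal configuration\<close>

text \<open>Take \<open>q = n / 3 + 1\<close> disjoint stars with \<open>q\<close> edges each. The
  partner of an edge consists of the \<open>q - 1\<close> other centres, the \<open>q - 1\<close>
  other leaves of its star and \<open>q - 1\<close> private vertices, \<open>n\<close> in all. There
  are \<open>q\<close> centres, \<open>q ^ 2\<close> leaves and \<open>q ^ 2 * (q - 1)\<close>
  private vertices, together \<open>q ^ 3 + q\<close>.\<close>

lemma set_pair_system_sharp:
  assumes "3 dvd n"
  shows "\<exists>m (A :: nat \<Rightarrow> nat set) (B :: nat \<Rightarrow> nat set).
    set_pair_system m A B \<and> sps_bounded 2 n m A B \<and> one_cross_intersecting m A B \<and>
    real (card (non_isolated m A B)) = (real n + 3) ^ 3 / 27 + (real n + 3) / 3"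
proof -
  define q where "q = n div 3 + 1"
  have nq: "n = 3 * (q - 1)" "q \<ge> 1" using assms by (auto simp: q_def)
  define P where "P = {..<q} \<times> {..<q}"
  have "finite P" by (simp add: P_def)
  then obtain h where "bij_betw h {0..<card P} P" using ex_bij_betw_nat_finite by blast
  \<comment> \<open>Edge labels start at 1, the enumeration of \<open>P\<close> at 0.\<close>
  moreover have "bij_betw (\<lambda>i. i - 1) {1..card P} {0..<card P}"
    by (rule bij_betw_byWitness[where f' = Suc]) auto
  ultimately obtain g where g: "bij_betw g {1..card P} P" using bij_betw_trans by blast
  \<comment> \<open>\<open>(s, q, 0)\<close> is the centre of star \<open>s\<close>, \<open>(s, t, 0)\<close> its leaves (\<open>t < q\<close>), and \<open>(s, t, r)\<close> with
    \<open>r \<ge> 1\<close> the vertices used only by the partner of the edge \<open>(s, t)\<close>.\<close>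
  define A0 B0 :: "nat \<times> nat \<Rightarrow> (nat \<times> nat \<times> nat) set"
    where "A0 = (\<lambda>(s, t). {(s, q, 0), (s, t, 0)})"
      and "B0 = (\<lambda>(s, t). (\<lambda>s. (s, q, 0)) ` ({..<q} - {s}) \<union>
            ((\<lambda>t. (s, t, 0)) ` ({..<q} - {t}) \<union> (\<lambda>r. (s, t, r)) ` {1..<q}))"
  have AB: "A0 e \<inter> B0 f = {} \<longleftrightarrow> e = f" "e \<noteq> f \<Longrightarrow> card (A0 e \<inter> B0 f) = 1"
    if "e \<in> P" "f \<in> P" for e f
  proof -
    obtain s t s' t' where ef: "e = (s, t)" "f = (s', t')" by (cases e, cases f)
    have b: "s < q" "t < q" "s' < q" "t' < q" using that by (auto simp: P_def ef)
    \<comment> \<open>A partner set meets an edge of another star in its centre and another edge of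
      the same star in its leaf.\<close>
    have eq: "A0 e \<inter> B0 f = (if s \<noteq> s' then {(s, q, 0)} else if t \<noteq> t' then {(s, t, 0)} else {})"
      using b by (auto simp: A0_def B0_def ef)
    show "A0 e \<inter> B0 f = {} \<longleftrightarrow> e = f" "e \<noteq> f \<Longrightarrow> card (A0 e \<inter> B0 f) = 1"
      unfolding eq by (auto simp: ef)
  qed
  have cA: "finite (A0 e)" "card (A0 e) \<le> 2" for e
    by (auto simp: A0_def card_insert_if split: prod.splits)
  have cB: "finite (B0 e)" "card (B0 e) \<le> n" if e: "e \<in> P" for e
  proof -
    obtain s t where st: "e = (s, t)" "s < q" "t < q" using e by (auto simp: P_def)
    show "finite (B0 e)" by (simp add: B0_def st)
    have "card (B0 e) \<le> card ((\<lambda>s. (s, q, 0 :: nat)) ` ({..<q} - {s}))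
        + (card ((\<lambda>t. (s, t, 0 :: nat)) ` ({..<q} - {t})) + card ((\<lambda>r. (s, t, r)) ` {1..<q}))"
      unfolding B0_def st(1) prod.case by (intro card_Un_le order_trans[OF card_Un_le] add_mono order_refl)
    also have "\<dots> = (q - 1) + ((q - 1) + (q - 1))"
      using st by (simp add: card_image inj_on_def)
    finally show "card (B0 e) \<le> n" using nq by simp
  qed
  have U: "(\<Union>e\<in>P. A0 e \<union> B0 e) = {..<q} \<times> {..<q} \<times> {..<q} \<union> (\<lambda>s. (s, q, 0)) ` {..<q}"
    (is "?L = ?R")
  proof
    show "?L \<subseteq> ?R" using nq(2) by (auto simp: A0_def B0_def P_def)
    show "?R \<subseteq> ?L"
    proof
      fix v assume "v \<in> ?R"
      then consider s t r where "v = (s, t, r)" "s < q" "t < q" "r < q" | s where "v = (s, q, 0)" "s < q"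
        by auto
      then show "v \<in> ?L"
      proof cases
        case 1
        then have "v \<in> A0 (s, t) \<union> B0 (s, t)" by (cases "r = 0") (auto simp: A0_def B0_def)
        then show ?thesis using 1 by (auto simp: P_def)
      next
        case 2
        then have "v \<in> A0 (s, 0)" by (simp add: A0_def)
        moreover have "(s, 0) \<in> P" using 2 nq(2) by (simp add: P_def)
        ultimately show ?thesis by blast
      qed
    qed
  qed
  have cU: "card (\<Union>e\<in>P. A0 e \<union> B0 e) = q * (q * q) + q"
  proof -
    have "card ({..<q} \<times> {..<q} \<times> {..<q} \<union> (\<lambda>s. (s, q, 0 :: nat)) ` {..<q})
        = card ({..<q} \<times> {..<q} \<times> {..<q}) + card ((\<lambda>s. (s, q, 0 :: nat)) ` {..<q})"
      by (intro card_Un_disjoint) auto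
    then show ?thesis unfolding U by (simp add: card_cartesian_product card_image inj_on_def)
  qed
  \<comment> \<open>The injection \<open>to_nat\<close> moves the triples to \<open>nat\<close> and
    preserves intersections and cardinalities.\<close>
  define A B :: "nat \<Rightarrow> nat set" where "A = (\<lambda>i. to_nat ` A0 (g i))" and "B = (\<lambda>i. to_nat ` B0 (g i))"
  have gP: "g i \<in> P" if "i \<in> {1..card P}" for i using bij_betwE[OF g] that by blast
  have gi: "g i = g j \<longleftrightarrow> i = j" if "i \<in> {1..card P}" "j \<in> {1..card P}" for i j
    using inj_on_eq_iff[OF bij_betw_imp_inj_on[OF g] that] .
  have int: "A i \<inter> B j = to_nat ` (A0 (g i) \<inter> B0 (g j))" for i j
    unfolding A_def B_def by (rule image_Int[symmetric]) simp
  have "set_pair_system (card P) A B"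
    unfolding set_pair_system_def int image_is_empty
  proof (intro ballI)
    fix i j assume ij: "i \<in> {1..card P}" "j \<in> {1..card P}"
    show "A0 (g i) \<inter> B0 (g j) \<noteq> {} \<longleftrightarrow> i \<noteq> j"
      unfolding AB(1)[OF ij[THEN gP]] gi[OF ij] ..
  qed
  moreover have "one_cross_intersecting (card P) A B"
    unfolding one_cross_intersecting_def int image_is_empty
  proof (intro ballI impI)
    fix i j assume ij: "i \<in> {1..card P}" "j \<in> {1..card P}" and "A0 (g i) \<inter> B0 (g j) \<noteq> {}"
    then have "card (A0 (g i) \<inter> B0 (g j)) = 1" using AB[OF ij[THEN gP]] by blast
    then show "card (to_nat ` (A0 (g i) \<inter> B0 (g j))) = 1" by (simp add: card_image)
  qed
  moreover have "sps_bounded 2 n (card P) A B"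
    unfolding sps_bounded_def A_def B_def using cA cB[OF gP] by (simp add: card_image)
  moreover have "non_isolated (card P) A B = to_nat ` (\<Union>e\<in>P. A0 e \<union> B0 e)"
  proof -
    have "P = g ` {1..card P}" using bij_betw_imp_surj_on[OF g] by (rule sym)
    then have "(\<Union>e\<in>P. A0 e \<union> B0 e) = (\<Union>i\<in>{1..card P}. A0 (g i) \<union> B0 (g i))"
      by (rule arg_cong[where f = Union, OF trans[OF image_cong[OF _ refl] image_image]])
    then show ?thesis unfolding non_isolated_def A_def B_def by auto
  qed
  then have "card (non_isolated (card P) A B) = q * (q * q) + q" using cU by (simp add: card_image)
  moreover have "real (q * (q * q) + q) = (real n + 3) ^ 3 / 27 + (real n + 3) / 3"
  proof -
    have "real n + 3 = 3 * real q" using nq by (simp add: of_nat_diff)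
    then show ?thesis by (simp add: power3_eq_cube)
  qed
  ultimately show ?thesis by (intro exI[of _ "card P"] exI[of _ A] exI[of _ B]) simp
qed

theorem theorem1p6:
  fixes n :: nat
  assumes "n \<ge> 2"
  shows "(\<forall>m (A :: nat \<Rightarrow> 'a set) (B :: nat \<Rightarrow> 'a set).
            set_pair_system m A B \<and> sps_bounded 2 n m A B \<and> one_cross_intersecting m A B \<longrightarrow>
            real (card (non_isolated m A B)) \<le> (real n + 3) ^ 3 / 27 + (real n + 3) / 3) \<and>
         (3 dvd n \<longrightarrow>
            (\<exists>m (A :: nat \<Rightarrow> nat set) (B :: nat \<Rightarrow> nat set).
               set_pair_system m A B \<and> sps_bounded 2 n m A B \<and> one_cross_intersecting m A B \<and>
               real (card (non_isolated m A B)) = (real n + 3) ^ 3 / 27 + (real n + 3) / 3))"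
  using set_pair_system_bound[OF assms] set_pair_system_sharp by blast

end
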